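(* Let $p$ be a prime, regard $\mathbb{C}_p$ as an ultrametric Banach space over $\mathbb{Q}_p$ with the $p$-adic absolute value $|\cdot|_p$, and for $n\ge 0$ let $\mathcal{A}_n=\{\alpha\in\mathbb{C}_p:\ \exists\, q\in\mathbb{Q}_p[t],\ q\neq 0,\ \deg q\le n,\ q(\alpha)=0\}$. Let $\{\varepsilon_n\}$ be a sequence of positive reals decreasing (non-increasingly) to $0$. Then there exists $\alpha\in\mathbb{C}_p\setminus\mathbb{Q}_p^a$ such that $E(\alpha,\mathcal{A}_n)=\inf_{a\in\mathcal{A}_n}|\alpha-a|_p\neq\mathbf{O}(\varepsilon_n)$, i.e. there is no constant $M>0$ with $E(\alpha,\mathcal{A}_n)\le M\varepsilon_n$ for all $n$.
   Context: $\mathbb{Q}_p$ is the field of $p$-adic numbers, $\mathbb{Q}_p^a$ its algebraic closure with the unique extension of $|\cdot|_p$, and $\mathbb{C}_p$ the completion of $\mathbb{Q}_p^a$. *)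

theory Defs
  imports "HOL-Analysis.Analysis" "HOL-Computational_Algebra.Computational_Algebra"
begin

definition padic_abs :: "nat \<Rightarrow> rat \<Rightarrow> real" where
  "padic_abs p x =
     (if x = 0 then 0
      else real p powi (int (multiplicity (int p) (snd (quotient_of x)))
                      - int (multiplicity (int p) (fst (quotient_of x)))))"

definition ultrametric_abs :: "('a::field \<Rightarrow> real) \<Rightarrow> bool" where
  "ultrametric_abs v \<longleftrightarrow>
     (\<forall>x. 0 \<le> v x) \<and> (\<forall>x. v x = 0 \<longleftrightarrow> x = 0) \<and>
     (\<forall>x y. v (x * y) = v x * v y) \<and> (\<forall>x y. v (x + y) \<le> max (v x) (v y))"

definition is_subfield :: "'a::field set \<Rightarrow> bool" where
  "is_subfield K \<longleftrightarrow>
     0 \<in> K \<and> 1 \<in> K \<and> (\<forall>x\<in>K. \<forall>y\<in>K. x - y \<in> K \<and> x * y \<in> K) \<and> (\<forall>x\<in>K. inverse x \<in> K)"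

definition is_completion :: "('a::field \<Rightarrow> real) \<Rightarrow> 'a set \<Rightarrow> 'a set \<Rightarrow> bool" where
  "is_completion v K L \<longleftrightarrow>
     is_subfield K \<and> is_subfield L \<and> K \<subseteq> L \<and>
     Metric_space.mcomplete L (\<lambda>x y. v (x - y)) \<and>
     Metric_space.mtopology L (\<lambda>x y. v (x - y)) closure_of K = L"

definition poly_over :: "'a::field set \<Rightarrow> 'a poly set" where
  "poly_over K = {q. \<forall>i. coeff q i \<in> K}"

definition is_algebraic_closure :: "'a::field set \<Rightarrow> 'a set \<Rightarrow> bool" where
  "is_algebraic_closure K L \<longleftrightarrow>
     is_subfield K \<and> is_subfield L \<and> K \<subseteq> L \<and>
     (\<forall>x\<in>L. \<exists>q\<in>poly_over K. q \<noteq> 0 \<and> poly q x = 0) \<and>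
     (\<forall>q\<in>poly_over L. 0 < degree q \<longrightarrow> (\<exists>x\<in>L. poly q x = 0))"

text \<open>The tower \<open>\<rat> \<subseteq> \<rat>\<^sub>p \<subseteq> \<rat>\<^sub>p\<^sup>a \<subseteq> \<complex>\<^sub>p\<close> inside the type \<open>'a\<close>, whose
  universe is \<open>\<complex>\<^sub>p\<close>. One function \<open>v\<close> carries the absolute values of all four fields,
  so each inclusion is isometric. These conditions determine the tower up to isometric
  isomorphism.\<close>
locale padic_complex_field =
  fixes p :: nat
    and v :: "'a::field_char_0 \<Rightarrow> real"
    and Qp Qpa :: "'a set"
  assumes abs: "ultrametric_abs v"
    and abs_rat: "\<And>x. v (of_rat x) = padic_abs p x"
    and Qp: "is_completion v \<rat> Qp"
    and Qpa: "is_algebraic_closure Qp Qpa"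
    and Cp: "is_completion v Qpa UNIV"

definition algebraic_deg_le :: "'a::field set \<Rightarrow> nat \<Rightarrow> 'a set" where
  "algebraic_deg_le K n = {\<alpha>. \<exists>q\<in>poly_over K. q \<noteq> 0 \<and> degree q \<le> n \<and> poly q \<alpha> = 0}"

text \<open>Only meaningful for \<open>A \<noteq> {}\<close>: the real infimum over the empty set is an unspecified
  value, not \<open>\<infinity>\<close>.\<close>
definition approx_error :: "('a::field \<Rightarrow> real) \<Rightarrow> 'a \<Rightarrow> 'a set \<Rightarrow> real" where
  "approx_error v \<alpha> A = (INF a\<in>A. v (\<alpha> - a))"

text \<open>The set \<open>algebraic_deg_le K 0\<close> is empty. Bounds on the error are therefore
  considered for \<open>n \<ge> 1\<close> only; under the convention \<open>inf {} = \<infinity>\<close> the index \<open>0\<close> would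
  by itself refute every bound.\<close>

end

theory Submission
  imports Defs
begin

text \<open>Let \<open>\<pi>\<^sub>0 = p\<close> and let \<open>\<pi>\<^sub>k\<^sub>+\<^sub>1\<close> be an \<open>(N\<^sub>k + 1)\<close>-th root of \<open>\<pi>\<^sub>k\<close>, so that
  \<open>\<rat>\<^sub>p[\<pi>\<^sub>k]\<close> is totally ramified of some degree \<open>Q\<^sub>k\<close> and its nonzero elements have absolute
  value \<open>p\<^sup>i\<close> with \<open>i \<in> (1/Q\<^sub>k)\<int>\<close>. If \<open>a\<close> has degree at most \<open>N\<^sub>k\<close> over \<open>\<rat>\<^sub>p\<close> and \<open>c \<in> \<rat>\<^sub>p[\<pi>\<^sub>k]\<close>,
  then \<open>a - c\<close> is a root of a polynomial of degree at most \<open>N\<^sub>k\<close> over \<open>\<rat>\<^sub>p[\<pi>\<^sub>k]\<close>; two of its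
  terms must have the same absolute value, so \<open>\<bar>a - c\<bar>\<close> is \<open>p\<^sup>i\<close> with \<open>i \<in> (1/(m Q\<^sub>k))\<int>\<close> and
  \<open>1 \<le> m \<le> N\<^sub>k\<close>. This can never be the absolute value of \<open>p\<^sup>k \<pi>\<^sub>k\<^sub>+\<^sub>1\<close>. Hence
  \<open>\<alpha> = \<Sum>\<^sub>k p\<^sup>k \<pi>\<^sub>k\<^sub>+\<^sub>1\<close> has distance at least \<open>\<bar>p\<^sup>k \<pi>\<^sub>k\<^sub>+\<^sub>1\<bar> \<ge> p\<^sup>-\<^sup>k\<^sup>-\<^sup>1\<close> from every such \<open>a\<close>,
  and \<open>N\<^sub>k\<close> may be taken so large that \<open>\<epsilon>\<close> at \<open>N\<^sub>k\<close> is much smaller than this.\<close>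

section \<open>Ultrametric absolute values: sums, roots of polynomials, series\<close>

locale ultrametric_field =
  fixes v :: "'a::field \<Rightarrow> real"
  assumes ultrametric: "ultrametric_abs v"
begin

lemma v_nonneg [simp]: "0 \<le> v x"
  using ultrametric by (auto simp: ultrametric_abs_def)

lemma v_eq_0_iff [simp]: "v x = 0 \<longleftrightarrow> x = 0"
  using ultrametric by (auto simp: ultrametric_abs_def)

lemma v_zero [simp]: "v 0 = 0"
  by simp

lemma v_mult: "v (x * y) = v x * v y"
  using ultrametric by (auto simp: ultrametric_abs_def)

lemma v_add: "v (x + y) \<le> max (v x) (v y)"
  using ultrametric by (auto simp: ultrametric_abs_def)

lemma v_pos_iff [simp]: "0 < v x \<longleftrightarrow> x \<noteq> 0"
  using v_nonneg[of x] v_eq_0_iff[of x] by linarith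

lemma v_one [simp]: "v 1 = 1"
  using v_mult[of 1 1] v_eq_0_iff[of 1] by simp

lemma v_minus [simp]: "v (- x) = v x"
proof -
  have "v (-1) * v (-1) = 1"
    using v_mult[of "-1" "-1"] by simp
  then have "v (-1) = 1"
    using v_nonneg[of "-1"] by (metis abs_of_nonneg power2_eq_square power2_eq_1_iff abs_neg_one abs_one)
  then show ?thesis
    using v_mult[of "-1" x] by simp
qed

lemma v_diff: "v (x - y) \<le> max (v x) (v y)"
  using v_add[of x "- y"] by simp

lemma v_diff_commute: "v (x - y) = v (y - x)"
  using v_minus[of "x - y"] by simp

lemma v_power: "v (x ^ n) = v x ^ n"
  by (induction n) (auto simp: v_mult)

text \<open>Since \<open>y = (x + y) - x\<close>, \<open>v y\<close> is at most the larger of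
  \<open>v (x + y)\<close> and \<open>v x\<close>, and the latter is excluded.\<close>

lemma v_add_eq_right: "v x < v y \<Longrightarrow> v (x + y) = v y"
  using v_add[of x y] v_diff[of "x + y" x] by simp

lemma Metric_space_v: "Metric_space UNIV (\<lambda>x y. v (x - y))"
proof
  fix x y z :: 'a
  have "v (x - z) \<le> max (v (x - y)) (v (y - z))"
    using v_add[of "x - y" "y - z"] by simp
  also have "\<dots> \<le> v (x - y) + v (y - z)"
    by simp
  finally show "v (x - z) \<le> v (x - y) + v (y - z)" .
qed (auto intro: v_diff_commute)

text \<open>By induction, a sum with a nonzero term takes its absolute value from one of its terms;
  a new nonzero term differs from it in absolute value, so the larger of the two wins by
  \<open>v_add_eq_right\<close>.\<close>

lemma v_sum_distinct:
  assumes "finite A"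
    and "\<And>i j. i \<in> A \<Longrightarrow> j \<in> A \<Longrightarrow> i \<noteq> j \<Longrightarrow> f i \<noteq> 0 \<Longrightarrow> f j \<noteq> 0 \<Longrightarrow> v (f i) \<noteq> v (f j)"
  shows "(\<forall>i\<in>A. f i = 0) \<or> (\<exists>i\<in>A. f i \<noteq> 0 \<and> v (sum f A) = v (f i))"
  using assms
proof (induction A rule: finite_induct)
  case (insert a A)
  then have IH: "(\<forall>i\<in>A. f i = 0) \<or> (\<exists>i\<in>A. f i \<noteq> 0 \<and> v (sum f A) = v (f i))"
    by blast
  show ?case
  proof (cases "f a = 0 \<or> (\<forall>i\<in>A. f i = 0)")
    case True
    with IH insert.hyps show ?thesis
      by auto
  next
    case False
    with IH obtain i where i: "i \<in> A" "f i \<noteq> 0" "v (sum f A) = v (f i)"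
      by blast
    moreover from i False insert.hyps insert.prems[of a i] have "v (f a) \<noteq> v (f i)"
      by blast
    ultimately have "v (f a + sum f A) = v (f a) \<or> v (f a + sum f A) = v (f i)"
      using v_add_eq_right[of "f a" "sum f A"] v_add_eq_right[of "sum f A" "f a"]
      by (metis add.commute linorder_neqE_linordered_idom)
    with i False insert.hyps show ?thesis
      by auto
  qed
qed simp

text \<open>The terms of \<open>poly q b\<close> sum to 0 although the leading one is nonzero, so
  \<open>v_sum_distinct\<close> forces two nonzero terms to agree in absolute value. Cancelling the
  lower power of \<open>b\<close> gives a slope of the Newton polygon.\<close>

lemma root_equal_terms:
  assumes "q \<noteq> 0" "poly q b = 0" "b \<noteq> 0"
  obtains i m where "0 < m" "i + m \<le> degree q" "coeff q i \<noteq> 0" "coeff q (i + m) \<noteq> 0"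
    "v (coeff q i) = v (coeff q (i + m)) * v b ^ m"
proof -
  define f where "f = (\<lambda>i. coeff q i * b ^ i)"
  have "sum f {..degree q} = 0"
    using assms(2) by (simp add: f_def poly_altdef)
  moreover have "f (degree q) \<noteq> 0"
    using assms by (simp add: f_def)
  ultimately have "\<not> ((\<forall>i\<in>{..degree q}. f i = 0) \<or>
      (\<exists>i\<in>{..degree q}. f i \<noteq> 0 \<and> v (sum f {..degree q}) = v (f i)))"
    by auto
  with v_sum_distinct[of "{..degree q}" f] obtain i j
    where "i \<le> degree q" "j \<le> degree q" "i \<noteq> j" "f i \<noteq> 0" "f j \<noteq> 0" "v (f i) = v (f j)"
    by auto
  then have "\<exists>i j. i < j \<and> j \<le> degree q \<and> f i \<noteq> 0 \<and> f j \<noteq> 0 \<and> v (f i) = v (f j)"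
    by (metis linorder_neqE_nat)
  then obtain i j where ij: "i < j" "j \<le> degree q" "f i \<noteq> 0" "f j \<noteq> 0" "v (f i) = v (f j)"
    by blast
  then obtain m where m: "j = i + m" "0 < m"
    using less_imp_add_positive by blast
  have "v (coeff q i) * v b ^ i = (v (coeff q j) * v b ^ m) * v b ^ i"
    using ij(5) by (simp add: f_def v_mult v_power m power_add mult_ac)
  with assms(3) have "v (coeff q i) = v (coeff q j) * v b ^ m"
    by simp
  with m ij show thesis
    by (intro that[of m i]) (auto simp: f_def)
qed

lemma v_partial_sum_diff:
  assumes "decseq (\<lambda>k. v (b k))" "k \<le> m"
  shows "v ((\<Sum>j<m. b j) - (\<Sum>j<k. b j)) \<le> v (b k)"
  using assms(2)
proof (induction m rule: dec_induct)
  case (step m)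
  have "v ((\<Sum>j<Suc m. b j) - (\<Sum>j<k. b j)) \<le> max (v ((\<Sum>j<m. b j) - (\<Sum>j<k. b j))) (v (b m))"
    using v_add[of "(\<Sum>j<m. b j) - (\<Sum>j<k. b j)" "b m"] by (simp add: algebra_simps)
  also have "\<dots> \<le> v (b k)"
    using step decseqD[OF assms(1), of k m] by simp
  finally show ?case .
qed simp

text \<open>Any two partial sums beyond \<open>k\<close> differ by at most \<open>v (b k)\<close>,
  so null terms alone make the series Cauchy, and the same bound passes to the limit.\<close>

lemma series_limit:
  assumes complete: "Metric_space.mcomplete UNIV (\<lambda>x y. v (x - y))"
    and dec: "decseq (\<lambda>k. v (b k))" and null: "(\<lambda>k. v (b k)) \<longlonglongrightarrow> 0"
  obtains \<alpha> where "\<And>k. v (\<alpha> - (\<Sum>j<k. b j)) \<le> v (b k)"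
proof -
  interpret M: Metric_space UNIV "\<lambda>x y. v (x - y)"
    by (rule Metric_space_v)
  define S where "S = (\<lambda>k. \<Sum>j<k. b j)"
  have "M.MCauchy S"
    unfolding M.MCauchy_def
  proof safe
    fix e :: real
    assume "0 < e"
    with null obtain K where K: "v (b K) < e"
      using eventually_happens[OF order_tendstoD(2)] by fastforce
    have "v (S m - S n) < e" if "K \<le> m" "K \<le> n" for m n
    proof -
      have "v (S m - S n) \<le> max (v (S m - S K)) (v (S n - S K))"
        using v_diff[of "S m - S K" "S n - S K"] by simp
      also have "\<dots> \<le> v (b K)"
        using that v_partial_sum_diff[OF dec] by (simp add: S_def)
      finally show ?thesis
        using K by simp
    qed
    then show "\<exists>K. \<forall>m n. K \<le> m \<longrightarrow> K \<le> n \<longrightarrow> v (S m - S n) < e"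
      by blast
  qed auto
  with complete obtain \<alpha> where "limitin M.mtopology S \<alpha> sequentially"
    unfolding M.mcomplete_def by blast
  then have lim: "\<And>e. 0 < e \<Longrightarrow> \<forall>\<^sub>F m in sequentially. v (S m - \<alpha>) < e"
    by (auto simp: M.limitin_metric)
  have "v (\<alpha> - S k) \<le> v (b k)" for k
  proof (rule field_le_epsilon)
    fix e :: real
    assume "0 < e"
    from eventually_conj[OF lim[OF this] eventually_ge_at_top[of k]]
    obtain m where m: "v (S m - \<alpha>) < e" "k \<le> m"
      using eventually_happens by fastforce
    have "v (\<alpha> - S k) \<le> max (v (S m - S k)) (v (S m - \<alpha>))"
      using v_diff[of "S m - S k" "S m - \<alpha>"] by simp
    also have "\<dots> \<le> v (b k) + e"
      using m \<open>0 < e\<close> v_partial_sum_diff[OF dec m(2)] v_nonneg[of "b k"] unfolding S_def by linarith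
    finally show "v (\<alpha> - S k) \<le> v (b k) + e" .
  qed
  then show thesis
    using that unfolding S_def by blast
qed

end

section \<open>Polynomials over a subfield and simple ring extensions\<close>

lemma is_subfield_add: "is_subfield K \<Longrightarrow> x \<in> K \<Longrightarrow> y \<in> K \<Longrightarrow> x + y \<in> K"
  unfolding is_subfield_def by (metis diff_0 diff_minus_eq_add)

lemma is_subfield_mult: "is_subfield K \<Longrightarrow> x \<in> K \<Longrightarrow> y \<in> K \<Longrightarrow> x * y \<in> K"
  unfolding is_subfield_def by blast

lemma is_subfield_0: "is_subfield K \<Longrightarrow> 0 \<in> K"
  unfolding is_subfield_def by blast

lemma is_subfield_1: "is_subfield K \<Longrightarrow> 1 \<in> K"
  unfolding is_subfield_def by blast

lemma is_subfield_sum: "is_subfield K \<Longrightarrow> (\<And>i. i \<in> A \<Longrightarrow> f i \<in> K) \<Longrightarrow> sum f A \<in> K"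
  by (induction A rule: infinite_finite_induct) (auto intro: is_subfield_0 is_subfield_add)

lemma poly_over_pCons_iff: "pCons a q \<in> poly_over K \<longleftrightarrow> a \<in> K \<and> q \<in> poly_over K"
proof
  assume "pCons a q \<in> poly_over K"
  then have "coeff (pCons a q) 0 \<in> K" "\<And>i. coeff (pCons a q) (Suc i) \<in> K"
    unfolding poly_over_def by blast+
  then show "a \<in> K \<and> q \<in> poly_over K"
    by (simp add: poly_over_def)
qed (auto simp: poly_over_def coeff_pCons split: nat.split)

lemma poly_over_0: "is_subfield K \<Longrightarrow> 0 \<in> poly_over K"
  by (simp add: poly_over_def is_subfield_0)

lemma poly_over_add: "is_subfield K \<Longrightarrow> f \<in> poly_over K \<Longrightarrow> g \<in> poly_over K \<Longrightarrow> f + g \<in> poly_over K"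
  by (simp add: poly_over_def is_subfield_add)

lemma poly_over_mult: "is_subfield K \<Longrightarrow> f \<in> poly_over K \<Longrightarrow> g \<in> poly_over K \<Longrightarrow> f * g \<in> poly_over K"
  by (simp add: poly_over_def coeff_mult is_subfield_sum is_subfield_mult)

text \<open>The ring \<open>K[x]\<close>; for \<open>x\<close> algebraic over a subfield
  \<open>K\<close> it is the field \<open>K(x)\<close>.\<close>

definition adjoin :: "'a::field set \<Rightarrow> 'a \<Rightarrow> 'a set" where
  "adjoin K x = (\<lambda>f. poly f x) ` poly_over K"

lemma adjoin_add:
  assumes "is_subfield K" "y \<in> adjoin K x" "z \<in> adjoin K x"
  shows "y + z \<in> adjoin K x"
  using assms(2,3) unfolding adjoin_def
  by clarify (metis poly_over_add[OF assms(1)] poly_add imageI)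

lemma adjoin_mult:
  assumes "is_subfield K" "y \<in> adjoin K x" "z \<in> adjoin K x"
  shows "y * z \<in> adjoin K x"
  using assms(2,3) unfolding adjoin_def
  by clarify (metis poly_over_mult[OF assms(1)] poly_mult imageI)

lemma adjoin_base:
  assumes "is_subfield K" "y \<in> K"
  shows "y \<in> adjoin K x"
  using assms unfolding adjoin_def
  by (intro image_eqI[of _ _ "[:y:]"]) (auto simp: poly_over_pCons_iff poly_over_0)

lemma adjoin_self:
  assumes "is_subfield K"
  shows "x \<in> adjoin K x"
  using assms unfolding adjoin_def
  by (intro image_eqI[of _ _ "[:0, 1:]"])
    (auto simp: poly_over_pCons_iff poly_over_0 is_subfield_0 is_subfield_1)

lemma adjoin_power:
  assumes "is_subfield K" "y \<in> adjoin K x"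
  shows "y ^ n \<in> adjoin K x"
  using assms by (induction n) (auto intro: adjoin_mult adjoin_base is_subfield_1)

lemma adjoin_subset:
  assumes K: "is_subfield K" and y: "y \<in> adjoin K x"
  shows "adjoin K y \<subseteq> adjoin K x"
proof -
  have "poly f y \<in> adjoin K x" if "f \<in> poly_over K" for f
    using that
  proof (induction f)
    case 0
    then show ?case
      by (simp add: adjoin_base K is_subfield_0)
  next
    case (pCons a f)
    then have "a \<in> adjoin K x" "poly f y \<in> adjoin K x"
      by (auto simp: poly_over_pCons_iff adjoin_base K)
    then show ?case
      by (simp add: adjoin_add adjoin_mult K y)
  qed
  then show ?thesis
    by (auto simp: adjoin_def)
qed

text \<open>Serves to move a root \<open>a\<close> of \<open>q\<close> to the root
  \<open>a - c\<close> of q(X + c), at the price of coefficients in \<open>K[x]\<close>.\<close>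

lemma poly_over_adjoin_pcompose:
  assumes K: "is_subfield K" and c: "c \<in> adjoin K x" and "q \<in> poly_over K"
  shows "pcompose q [:c, 1:] \<in> poly_over (adjoin K x)"
proof -
  have "coeff (pcompose q [:c, 1:]) i \<in> adjoin K x" for i
  proof (rule coeff_pcompose_semiring_closed)
    show "coeff q i \<in> adjoin K x" for i
      using assms(3) by (simp add: poly_over_def adjoin_base K)
    show "coeff [:c, 1:] i \<in> adjoin K x" for i
      using c K by (auto simp: coeff_pCons adjoin_base is_subfield_0 is_subfield_1 split: nat.split)
  qed (auto intro: adjoin_add adjoin_mult adjoin_base is_subfield_0 K)
  then show ?thesis
    by (simp add: poly_over_def)
qed

lemma adjoin_root_of_base:
  assumes K: "is_subfield K" and x: "x ^ Q \<in> K" "0 < Q" and y: "y \<in> adjoin K x"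
  obtains c where "\<And>i. c i \<in> K" "y = (\<Sum>i<Q. c i * x ^ i)"
proof -
  obtain Q' where Q: "Q = Suc Q'"
    using x(2) gr0_implies_Suc by blast
  have "\<exists>c. (\<forall>i. c i \<in> K) \<and> poly f x = (\<Sum>i<Q. c i * x ^ i)" if "f \<in> poly_over K" for f
    using that
  proof (induction f)
    case 0
    then show ?case
      by (intro exI[of _ "\<lambda>_. 0"]) (simp add: K is_subfield_0)
  next
    case (pCons a f)
    then obtain c where c: "\<And>i. c i \<in> K" "poly f x = (\<Sum>i<Q. c i * x ^ i)"
      and a: "a \<in> K"
      by (auto simp: poly_over_pCons_iff)
    \<comment> \<open>Multiplication by \<open>x\<close> shifts the coefficients up by one; the top
      one meets \<open>x ^ Q\<close>, which lies in \<open>K\<close>, and wraps around into the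
      constant term.\<close>
    define d where "d = case_nat (a + c Q' * x ^ Q) c"
    have "poly (pCons a f) x = (a + c Q' * x ^ Q) + (\<Sum>i<Q'. c i * x ^ Suc i)"
      by (simp add: c(2) Q sum_distrib_left algebra_simps)
    also have "\<dots> = (\<Sum>i<Q. d i * x ^ i)"
      unfolding Q sum.lessThan_Suc_shift by (simp add: d_def Q)
    finally have "poly (pCons a f) x = (\<Sum>i<Q. d i * x ^ i)" .
    moreover have "d i \<in> K" for i
      using a c(1) x(1) K by (auto simp: d_def is_subfield_add is_subfield_mult split: nat.split)
    ultimately show ?case
      by blast
  qed
  with y that show thesis
    unfolding adjoin_def by blast
qed

section \<open>Absolute values on \<open>Qp\<close> and on its extensions by roots of p\<close>

locale prime_padic_complex_field = padic_complex_field p v Qp Qpa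
  for p and v :: "'a::field_char_0 \<Rightarrow> real" and Qp Qpa +
  assumes prime_p: "prime p"
begin

sublocale ultrametric_field v
  using abs by unfold_locales

lemma subfield_Qp: "is_subfield Qp"
  using Qp by (simp add: is_completion_def)

lemma p_gt_1: "1 < real p"
  using prime_gt_1_nat[OF prime_p] by simp

lemma powi_p_inject: "real p powi i = real p powi j \<Longrightarrow> i = j"
  using p_gt_1 power_int_strict_increasing[of i j "real p"] power_int_strict_increasing[of j i "real p"]
  by (cases i j rule: linorder_cases) auto

lemma v_p: "v (of_nat p) = inverse (real p)"
proof -
  have "padic_abs p (of_nat p) = real p powi - 1"
    using prime_p prime_gt_0_nat[OF prime_p]
    by (auto simp: padic_abs_def quotient_of_int[of "int p", simplified] multiplicity_self not_prime_unit)
  then show ?thesis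
    using abs_rat[of "of_nat p"] by simp
qed

lemma of_nat_p_in_Qp: "of_nat p \<in> Qp"
  using Qp unfolding is_completion_def by (metis Rats_of_nat subsetD)

text \<open>The rationals are dense in \<open>Qp\<close>, and a rational closer to \<open>x\<close>
  than \<open>v x\<close> has the same absolute value as \<open>x\<close>.\<close>

lemma v_Qp:
  assumes "x \<in> Qp" "x \<noteq> 0"
  obtains i where "v x = real p powi i"
proof -
  interpret M: Metric_space Qp "\<lambda>x y. v (x - y)"
    using Metric_space.subspace[OF Metric_space_v] by simp
  have "x \<in> M.mtopology closure_of \<rat>"
    using Qp assms(1) by (simp add: is_completion_def)
  then have "\<forall>r>0. \<exists>y\<in>\<rat>. v (x - y) < r"
    by (fastforce simp: M.metric_closure_of)
  with assms(2) obtain y where y: "y \<in> \<rat>" "v (x - y) < v x"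
    by (meson v_pos_iff)
  then have "v (y - x) < v x"
    by (simp add: v_diff_commute)
  then have "v y = v x"
    using v_add_eq_right[of "y - x" x] by simp
  moreover from y obtain r where "y = of_rat r"
    by (auto simp: Rats_def)
  ultimately have "v x = padic_abs p r" "r \<noteq> 0"
    using abs_rat[of r] assms(2) by auto
  then show thesis
    using that by (simp add: padic_abs_def)
qed

text \<open>As a power of p, \<open>v (c i * \<pi> ^ i)\<close> has exponent e - i/Q with e an
  integer. For different \<open>i < Q\<close> these differ modulo 1, so a single term determines
  \<open>v y\<close>. The \<open>Q\<close>-th power clears the denominator.\<close>

lemma v_adjoin_root_p:
  assumes \<pi>: "\<pi> ^ Q = of_nat p" "0 < Q" and y: "y \<in> adjoin Qp \<pi>" "y \<noteq> 0"
  obtains i where "v y ^ Q = real p powi i"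
proof -
  obtain c where c: "\<And>i. c i \<in> Qp" "y = (\<Sum>i<Q. c i * \<pi> ^ i)"
    using adjoin_root_of_base[OF subfield_Qp _ \<pi>(2) y(1)] of_nat_p_in_Qp \<pi>(1) by metis
  have v\<pi>: "v \<pi> ^ Q = real p powi - 1"
    using v_power[of \<pi> Q] by (simp add: \<pi> v_p)
  have val: "\<exists>e. v (c i * \<pi> ^ i) ^ Q = real p powi (e * int Q - int i)"
    if nz: "c i \<noteq> 0" for i
  proof -
    obtain e where "v (c i) = real p powi e"
      using v_Qp[OF c(1) nz] by blast
    then have "v (c i * \<pi> ^ i) ^ Q = (real p powi e) ^ Q * (real p powi - 1) ^ i"
      by (simp only: v_mult v_power power_mult_distrib mult.commute[of i Q] flip: v\<pi> power_mult)
    also have "\<dots> = real p powi (e * int Q - int i)"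
      using p_gt_1 by (simp add: power_int_diff power_int_mult power_inverse field_simps)
    finally show ?thesis
      by blast
  qed
  have distinct: "v (c i * \<pi> ^ i) \<noteq> v (c j * \<pi> ^ j)"
    if ij: "i < Q" "j < Q" "i \<noteq> j" and nz: "c i \<noteq> 0" "c j \<noteq> 0" for i j
  proof
    assume eq: "v (c i * \<pi> ^ i) = v (c j * \<pi> ^ j)"
    obtain e e' where "real p powi (e * int Q - int i) = real p powi (e' * int Q - int j)"
      using val[OF nz(1)] val[OF nz(2)] eq by metis
    then have "e * int Q - int i = e' * int Q - int j"
      by (rule powi_p_inject)
    then have "int i - int j = (e - e') * int Q"
      by (simp add: algebra_simps)
    then have "int Q dvd int i - int j"
      by simp
    with ij show False
      by (metis dvd_minus_iff mod_eq_dvd_iff of_nat_eq_iff of_nat_mod mod_less)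
  qed
  have "(\<forall>i\<in>{..<Q}. c i * \<pi> ^ i = 0) \<or>
      (\<exists>i\<in>{..<Q}. c i * \<pi> ^ i \<noteq> 0 \<and> v y = v (c i * \<pi> ^ i))"
    unfolding c(2) by (rule v_sum_distinct) (use distinct in auto)
  moreover have "\<not> (\<forall>i\<in>{..<Q}. c i * \<pi> ^ i = 0)"
    using y(2) sum.neutral[of "{..<Q}" "\<lambda>i. c i * \<pi> ^ i"] unfolding c(2) by blast
  ultimately obtain i where "c i \<noteq> 0" "v y = v (c i * \<pi> ^ i)"
    by auto
  with val[of i] that show thesis
    by metis
qed

text \<open>\<open>root_equal_terms\<close> for q(X + c) makes \<open>v (a - c) ^ m\<close> a
  quotient of absolute values of two nonzero elements of \<open>Qp[\<pi>]\<close>.\<close>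

lemma v_algebraic_minus_adjoin:
  assumes \<pi>: "\<pi> ^ Q = of_nat p" "0 < Q" and c: "c \<in> adjoin Qp \<pi>"
    and a: "a \<in> algebraic_deg_le Qp n" "a \<noteq> c"
  obtains m i where "0 < m" "m \<le> n" "v (a - c) ^ (m * Q) = real p powi i"
proof -
  obtain q where q: "q \<in> poly_over Qp" "q \<noteq> 0" "degree q \<le> n" "poly q a = 0"
    using a(1) by (auto simp: algebraic_deg_le_def)
  define r where "r = pcompose q [:c, 1:]"
  have coeffs: "coeff r i \<in> adjoin Qp \<pi>" for i
    using poly_over_adjoin_pcompose[OF subfield_Qp c q(1)] by (simp add: poly_over_def r_def)
  have "r \<noteq> 0" "degree r \<le> n"
    using q by (auto simp: r_def degree_pcompose pcompose_eq_0_iff)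
  moreover have "poly r (a - c) = 0"
    using q by (simp add: r_def poly_pcompose)
  ultimately obtain i m where im: "0 < m" "i + m \<le> n" "coeff r i \<noteq> 0" "coeff r (i + m) \<noteq> 0"
    "v (coeff r i) = v (coeff r (i + m)) * v (a - c) ^ m"
    using root_equal_terms[of r "a - c"] a(2) by (metis eq_iff_diff_eq_0 le_trans)
  obtain e e' where e: "v (coeff r i) ^ Q = real p powi e" "v (coeff r (i + m)) ^ Q = real p powi e'"
    using v_adjoin_root_p[OF \<pi> coeffs] im by metis
  have "real p powi e = real p powi e' * v (a - c) ^ (m * Q)"
    by (simp add: im(5) power_mult_distrib power_mult flip: e)
  then have "v (a - c) ^ (m * Q) = real p powi (e - e')"
    using p_gt_1 by (simp add: power_int_diff field_simps)
  with im show thesis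
    by (intro that[of m]) auto
qed

lemma v_algebraic_minus_adjoin_neq:
  assumes \<pi>: "\<pi> ^ Q = of_nat p" "0 < Q" and c: "c \<in> adjoin Qp \<pi>"
    and a: "a \<in> algebraic_deg_le Qp n" and \<rho>: "\<rho> ^ Suc n = \<pi>"
  shows "v (a - c) \<noteq> v (of_nat p ^ k * \<rho>)"
proof
  assume eq: "v (a - c) = v (of_nat p ^ k * \<rho>)"
  \<comment> \<open>The common absolute value is thus nonzero, which rules out
    \<open>a = c\<close>.\<close>
  have "\<rho> \<noteq> 0"
    using \<rho> \<pi> prime_gt_0_nat[OF prime_p] by (metis power_0_left of_nat_eq_0_iff gr0_conv_Suc nat.simps(3) not_gr0)
  then have "a \<noteq> c"
    using eq prime_gt_0_nat[OF prime_p] v_eq_0_iff[of "of_nat p ^ k * \<rho>"] v_eq_0_iff[of "a - c"] by auto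
  then obtain m i where m: "0 < m" "m \<le> n" "v (a - c) ^ (m * Q) = real p powi i"
    using v_algebraic_minus_adjoin[OF \<pi> c a] by metis
  have v\<rho>: "v \<rho> ^ (Suc n * Q) = real p powi - 1"
    using v_power[of \<pi> Q] v_power[of \<rho> "Suc n"] \<pi> \<rho> by (simp add: power_mult v_p del: power_Suc mult_Suc)
  \<comment> \<open>Both sides are raised to the power \<open>m * Q * Suc n\<close>, which makes
    every exponent of p integral. Only the contribution \<open>m\<close> of \<rho> is not visibly a
    multiple of \<open>Suc n\<close>, yet \<open>0 < m \<le> n\<close>.\<close>
  have "real p powi (i * int (Suc n)) = (v (a - c) ^ (m * Q)) ^ Suc n"
    by (simp add: m(3) power_int_mult del: power_Suc of_nat_Suc)
  also have "\<dots> = inverse (real p) ^ (k * m * Q * Suc n) * (v \<rho> ^ (Suc n * Q)) ^ m"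
    by (simp add: eq v_mult v_power v_p power_mult_distrib mult_ac flip: power_mult del: power_Suc mult_Suc mult_Suc_right)
  also have "\<dots> = real p powi (- int (k * m * Q * Suc n) - int m)"
    unfolding v\<rho> using p_gt_1
    by (simp add: power_int_diff power_int_minus power_inverse field_simps del: power_Suc of_nat_Suc of_nat_mult mult_Suc mult_Suc_right)
  finally have "i * int (Suc n) = - int (k * m * Q * Suc n) - int m"
    by (rule powi_p_inject)
  then have "int m = (- i - int (k * m * Q)) * int (Suc n)"
    by (simp add: algebra_simps)
  then have "Suc n dvd m"
    by (metis dvd_triv_right int_dvd_int_iff)
  with m show False
    by (auto dest: dvd_imp_le)
qed

section \<open>The tower of roots and the number \<alpha>\<close>

lemma root_in_Qpa:
  assumes "x \<in> Qpa"
  obtains y where "y \<in> Qpa" "y ^ Suc n = x"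
proof -
  define q where "q = monom 1 (Suc n) + [:- x:]"
  have K: "is_subfield Qpa"
    using Qpa by (simp add: is_algebraic_closure_def)
  then have "0 \<in> Qpa" "1 \<in> Qpa" "- x \<in> Qpa"
    using assms unfolding is_subfield_def by (blast, blast, metis diff_0)
  then have "q \<in> poly_over Qpa"
    by (auto simp: poly_over_def q_def coeff_pCons split: nat.split)
  moreover have "degree q = Suc n"
    unfolding q_def by (subst degree_add_eq_left) (auto simp: degree_monom_eq)
  ultimately obtain y where "y \<in> Qpa" "poly q y = 0"
    using Qpa unfolding is_algebraic_closure_def by (metis zero_less_Suc)
  then show thesis
    using that[of y] by (simp add: q_def poly_monom)
qed

lemma root_tower:
  obtains \<pi> :: "nat \<Rightarrow> 'a" where "\<pi> 0 = of_nat p" "\<And>k. \<pi> (Suc k) ^ Suc (N k) = \<pi> k"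
proof -
  have "of_nat p \<in> Qpa"
    using of_nat_p_in_Qp Qpa by (auto simp: is_algebraic_closure_def)
  \<comment> \<open>The clause for \<open>k = 0\<close> fixes the starting value in dependent
    choice; membership in \<open>Qpa\<close> is carried along so that the next root exists.\<close>
  then obtain \<pi> where "\<forall>k. \<pi> k \<in> Qpa \<and> (k = 0 \<longrightarrow> \<pi> k = of_nat p)"
    "\<forall>k. \<pi> (Suc k) ^ Suc (N k) = \<pi> k"
    using dependent_nat_choice[of "\<lambda>k x. x \<in> Qpa \<and> (k = 0 \<longrightarrow> x = of_nat p)" "\<lambda>k x y. y ^ Suc (N k) = x"]
      root_in_Qpa by (metis nat.simps(3))
  then show thesis
    using that by blast
qed

text \<open>A point \<open>a\<close> too close to \<alpha> would have distance exactly
  \<open>v (b k)\<close> from the \<open>k\<close>-th partial sum, which lies in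
  \<open>Qp[\<pi> k]\<close>; this contradicts \<open>v_algebraic_minus_adjoin_neq\<close>. The
  degrees \<open>N\<close> stay arbitrary, to be adapted to \<epsilon> later.\<close>

lemma far_from_bounded_degree:
  fixes N :: "nat \<Rightarrow> nat"
  obtains \<alpha> where "\<And>k a. a \<in> algebraic_deg_le Qp (N k) \<Longrightarrow> inverse (real p) ^ Suc k \<le> v (\<alpha> - a)"
proof -
  obtain \<pi> :: "nat \<Rightarrow> 'a" where \<pi>: "\<pi> 0 = of_nat p" "\<And>k. \<pi> (Suc k) ^ Suc (N k) = \<pi> k"
    by (rule root_tower[of N]) blast
  define Q where "Q = (\<lambda>k. \<Prod>j<k. Suc (N j))"
  have Q: "\<pi> k ^ Q k = of_nat p" "0 < Q k" for k
  proof (induction k)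
    case (Suc k)
    have "\<pi> (Suc k) ^ Q (Suc k) = (\<pi> (Suc k) ^ Suc (N k)) ^ Q k"
      unfolding Q_def by (simp only: prod.lessThan_Suc mult.commute flip: power_mult)
    then show "\<pi> (Suc k) ^ Q (Suc k) = of_nat p"
      using Suc by (simp only: \<pi>(2))
  qed (auto simp: Q_def \<pi>)
  define b where "b = (\<lambda>k. of_nat p ^ k * \<pi> (Suc k))"
  \<comment> \<open>Taking roots of a number in (0, 1) never decreases it and keeps it below
    1.\<close>
  have v\<pi>: "inverse (real p) \<le> v (\<pi> k) \<and> v (\<pi> k) < 1" for k
  proof (induction k)
    case 0
    then show ?case
      using p_gt_1 by (simp add: \<pi> v_p inverse_less_1_iff)
  next
    case (Suc k)
    have eq: "v (\<pi> (Suc k)) ^ Suc (N k) = v (\<pi> k)"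
      by (simp only: \<pi>(2) flip: v_power)
    with Suc have lt: "v (\<pi> (Suc k)) < 1"
      by (metis linorder_not_less one_le_power)
    moreover have "v (\<pi> (Suc k)) ^ Suc (N k) \<le> v (\<pi> (Suc k))"
      using power_decreasing[of 1 "Suc (N k)" "v (\<pi> (Suc k))"] lt by simp
    ultimately show ?case
      using Suc eq by linarith
  qed
  have vb: "v (b k) = inverse (real p) ^ k * v (\<pi> (Suc k))" for k
    by (simp add: b_def v_mult v_power v_p)
  have p_pos: "0 < inverse (real p)" "inverse (real p) < 1"
    using p_gt_1 by (auto simp: inverse_less_1_iff)
  have lower: "inverse (real p) ^ Suc k \<le> v (b k)" for k
    using v\<pi>[of "Suc k"] p_pos by (simp add: vb mult.commute)
  have upper: "v (b k) < inverse (real p) ^ k" for k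
    using v\<pi>[of "Suc k"] p_pos by (simp add: vb)
  \<comment> \<open>The upper bound at \<open>Suc k\<close> and the lower bound at \<open>k\<close>
    are the same power of 1/p.\<close>
  have decreasing: "v (b (Suc k)) < v (b k)" for k
    using upper[of "Suc k"] lower[of k] by linarith
  have dec: "decseq (\<lambda>k. v (b k))"
    using decreasing by (intro decseq_SucI less_imp_le)
  have "(\<lambda>k. inverse (real p) ^ k) \<longlonglongrightarrow> 0"
    using p_pos by (intro LIMSEQ_power_zero) simp
  then have null: "(\<lambda>k. v (b k)) \<longlonglongrightarrow> 0"
    by (rule Lim_null_comparison[rotated]) (simp add: upper less_imp_le)
  obtain \<alpha> where \<alpha>: "\<And>k. v (\<alpha> - (\<Sum>j<k. b j)) \<le> v (b k)"
    using series_limit[OF _ dec null] Cp unfolding is_completion_def by metis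
  \<comment> \<open>The sum stops before \<open>b k\<close>, so the last root that occurs is
    \<open>\<pi> k\<close>.\<close>
  have S: "(\<Sum>j<k. b j) \<in> adjoin Qp (\<pi> k)" for k
  proof (induction k)
    case 0
    then show ?case
      by (simp add: adjoin_base subfield_Qp is_subfield_0)
  next
    case (Suc k)
    have "\<pi> k \<in> adjoin Qp (\<pi> (Suc k))"
      by (metis \<pi>(2) adjoin_power adjoin_self subfield_Qp)
    then have "(\<Sum>j<k. b j) \<in> adjoin Qp (\<pi> (Suc k))"
      using Suc adjoin_subset subfield_Qp by blast
    moreover have "b k \<in> adjoin Qp (\<pi> (Suc k))"
      unfolding b_def
      by (intro adjoin_mult adjoin_power adjoin_base adjoin_self subfield_Qp of_nat_p_in_Qp)
    ultimately show ?case
      by (simp add: adjoin_add subfield_Qp)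
  qed
  have "inverse (real p) ^ Suc k \<le> v (\<alpha> - a)" if a: "a \<in> algebraic_deg_le Qp (N k)" for k a
  proof (rule ccontr)
    assume "\<not> ?thesis"
    with lower[of k] have "v (\<alpha> - a) < v (b k)"
      by linarith
    moreover have "v (\<alpha> - (\<Sum>j<Suc k. b j)) < v (b k)"
      using \<alpha>[of "Suc k"] decreasing[of k] by linarith
    \<comment> \<open>The difference is \<open>a\<close> minus the partial sum including
      \<open>b k\<close>; adding \<open>b k\<close> back gives a sum dominated by
      \<open>b k\<close>.\<close>
    ultimately have "v ((\<alpha> - (\<Sum>j<Suc k. b j)) - (\<alpha> - a)) < v (b k)"
      using v_diff[of "\<alpha> - (\<Sum>j<Suc k. b j)" "\<alpha> - a"] by linarith
    then have "v ((a - (\<Sum>j<k. b j) - b k) + b k) = v (b k)"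
      by (intro v_add_eq_right) (simp add: algebra_simps)
    then have "v (a - (\<Sum>j<k. b j)) = v (of_nat p ^ k * \<pi> (Suc k))"
      by (simp add: b_def)
    with v_algebraic_minus_adjoin_neq[OF Q S a \<pi>(2)] show False
      by blast
  qed
  with that show thesis
    by blast
qed

section \<open>Sets of bounded degree and the choice of \<open>N\<close>\<close>

lemma in_Qpa_imp_algebraic_deg_le:
  assumes "x \<in> Qpa"
  obtains d where "\<And>n. d \<le> n \<Longrightarrow> x \<in> algebraic_deg_le Qp n"
proof -
  obtain q where "q \<in> poly_over Qp" "q \<noteq> 0" "poly q x = 0"
    using Qpa assms unfolding is_algebraic_closure_def by blast
  then show thesis
    by (intro that[of "degree q"]) (auto simp: algebraic_deg_le_def)
qed

text \<open>Guarantees that the infimum in \<open>approx_error\<close> is over a nonempty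
  set.\<close>

lemma zero_in_algebraic_deg_le:
  assumes "1 \<le> n"
  shows "0 \<in> algebraic_deg_le Qp n"
  using assms unfolding algebraic_deg_le_def
  by (auto intro!: bexI[of _ "[:0, 1:]"]
      simp: poly_over_pCons_iff poly_over_0 subfield_Qp is_subfield_0 is_subfield_1)

end

theorem theorem3p1:
  fixes p :: nat
    and v :: "'a::field_char_0 \<Rightarrow> real"
    and Qp Qpa :: "'a set"
    and \<epsilon> :: "nat \<Rightarrow> real"
  assumes "prime p"
    and "padic_complex_field p v Qp Qpa"
    and "\<And>n. 0 < \<epsilon> n"
    and "decseq \<epsilon>"
    and "\<epsilon> \<longlonglongrightarrow> 0"
  shows "\<exists>\<alpha>. \<alpha> \<notin> Qpa \<and>
    \<not> (\<exists>M>0. \<forall>n\<ge>1. approx_error v \<alpha> (algebraic_deg_le Qp n) \<le> M * \<epsilon> n)"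
proof -
  interpret padic_complex_field p v Qp Qpa
    by fact
  interpret prime_padic_complex_field p v Qp Qpa
    by unfold_locales fact
  define \<delta> where "\<delta> = (\<lambda>k. inverse (real p) ^ Suc k)"
  have \<delta>: "0 < \<delta> k" for k
    using p_gt_1 by (simp add: \<delta>_def)
  \<comment> \<open>The factor \<open>Suc k\<close> will outgrow any constant \<open>M\<close>;
    \<open>Suc k \<le> n\<close> makes the degrees unbounded, so that \<alpha> cannot be
    algebraic.\<close>
  have "\<exists>n. Suc k \<le> n \<and> \<epsilon> n * real (Suc k) < \<delta> k" for k
  proof -
    have "\<forall>\<^sub>F n in sequentially. \<epsilon> n < \<delta> k / real (Suc k)"
      using assms(5) \<delta> by (intro order_tendstoD) auto
    from eventually_conj[OF this eventually_ge_at_top[of "Suc k"]] show ?thesis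
      using eventually_happens by (fastforce simp: pos_less_divide_eq)
  qed
  then obtain N where N: "\<And>k. Suc k \<le> N k" "\<And>k. \<epsilon> (N k) * real (Suc k) < \<delta> k"
    by metis
  obtain \<alpha> where \<alpha>: "\<And>k a. a \<in> algebraic_deg_le Qp (N k) \<Longrightarrow> \<delta> k \<le> v (\<alpha> - a)"
    unfolding \<delta>_def by (rule far_from_bounded_degree[of N]) blast
  have "\<alpha> \<notin> Qpa"
  proof
    assume "\<alpha> \<in> Qpa"
    then obtain d where "\<And>n. d \<le> n \<Longrightarrow> \<alpha> \<in> algebraic_deg_le Qp n"
      using in_Qpa_imp_algebraic_deg_le by blast
    \<comment> \<open>For \<open>d \<le> N d\<close>, \<alpha> would itself be one of the points it
      must stay away from.\<close>
    with N(1)[of d] have "\<delta> d \<le> v (\<alpha> - \<alpha>)"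
      by (intro \<alpha>) auto
    with \<delta>[of d] show False
      by simp
  qed
  moreover have False
    if M: "\<forall>n\<ge>1. approx_error v \<alpha> (algebraic_deg_le Qp n) \<le> M * \<epsilon> n" for M
  proof -
    obtain k where k: "M < real (Suc k)"
      by (metis reals_Archimedean2 less_trans of_nat_less_iff lessI)
    have "1 \<le> N k"
      using N(1)[of k] by simp
    then have "\<delta> k \<le> approx_error v \<alpha> (algebraic_deg_le Qp (N k))"
      unfolding approx_error_def using zero_in_algebraic_deg_le \<alpha> by (intro cINF_greatest) auto
    also have "\<dots> \<le> M * \<epsilon> (N k)"
      using M \<open>1 \<le> N k\<close> by blast
    also have "\<dots> \<le> real (Suc k) * \<epsilon> (N k)"
      using k assms(3)[of "N k"] by (intro mult_right_mono) auto
    also have "\<dots> < \<delta> k"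
      using N(2)[of k] by (simp add: mult.commute)
    finally show False
      by simp
  qed
  ultimately show ?thesis
    by blast
qed

end
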